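(* (i) For a graph $G$ with $n$ vertices and $m$ edges, $$I_Q^1(G)\le 1-\frac{1}{2m}-\frac1n.$$ (ii) Let $G$ be a graph with $n$ vertices and $m$ edges, with minimum degree $\delta$ and maximum degree $\Delta$. Then $$I_Q^1(G)\ge 1-\frac{1}{2m}-\frac{1}{2n}-\frac{\Delta^2+\delta^2}{4n\Delta\delta},$$ with equality if and only if $G$ is a regular graph, or $G$ is a graph whose vertices have exactly two degrees $\Delta$ and $\delta$, such that $\Delta+\delta$ divides $\delta n$ and there are exactly $p=\frac{\delta n}{\delta+\Delta}$ vertices of degree $\Delta$ and $q=\frac{\Delta n}{\delta+\Delta}$ vertices of degree $\delta$.
   Context: The signless Laplacian matrix of a graph $G$ is $Q(G)=D(G)+A(G)$, where $D(G)$ is the diagonal matrix of vertex degrees and $A(G)$ is the adjacency matrix; let $q_1,\dots,q_n$ be its eigenvalues. Put $p_i=|q_i|/\sum_{j=1}^n|q_j|$. The generalized graph entropy $I_Q^1(G)$ is $I_Q^1(G)=\sum_{i=1}^n p_i(1-p_i)$. *)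

theory Defs
  imports
    "Graph_Theory.Pair_Digraph"
    "Jordan_Normal_Form.Char_Poly"
    "HOL-Computational_Algebra.Fundamental_Theorem_Algebra"
begin

text \<open>
  A finite simple undirected graph is a \<^locale>\<open>pair_graph\<close>: a finite, loop-free, symmetric digraph
  without multiple arcs. An undirected edge corresponds to a pair of opposite arcs, hence the
  edges are taken to be the unordered pairs of end points, and the degree of a vertex is its
  out-degree.
\<close>

definition edges :: "'v pair_pre_digraph \<Rightarrow> 'v set set" where
  "edges G = {{u, v} | u v. (u, v) \<in> parcs G}"

definition vdegree :: "'v pair_pre_digraph \<Rightarrow> 'v \<Rightarrow> nat" where
  "vdegree G v = out_degree (with_proj G) v"

definition min_degree :: "'v pair_pre_digraph \<Rightarrow> nat" where
  "min_degree G = Min (vdegree G ` pverts G)"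

definition max_degree :: "'v pair_pre_digraph \<Rightarrow> nat" where
  "max_degree G = Max (vdegree G ` pverts G)"

definition regular :: "'v pair_pre_digraph \<Rightarrow> bool" where
  "regular G \<longleftrightarrow> (\<exists>k. \<forall>v \<in> pverts G. vdegree G v = k)"

text \<open>The list \<open>vs\<close> enumerates the vertices; it fixes the order of the rows and columns.\<close>

definition adjacency_matrix :: "'v pair_pre_digraph \<Rightarrow> 'v list \<Rightarrow> real mat" where
  "adjacency_matrix G vs =
     mat (length vs) (length vs) (\<lambda>(i, j). if (vs ! i, vs ! j) \<in> parcs G then 1 else 0)"

definition degree_matrix :: "'v pair_pre_digraph \<Rightarrow> 'v list \<Rightarrow> real mat" where
  "degree_matrix G vs =
     mat (length vs) (length vs) (\<lambda>(i, j). if i = j then real (vdegree G (vs ! i)) else 0)"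

definition signless_Laplacian :: "'v pair_pre_digraph \<Rightarrow> 'v list \<Rightarrow> real mat" where
  "signless_Laplacian G vs = degree_matrix G vs + adjacency_matrix G vs"

text \<open>
  The eigenvalues with algebraic multiplicity. They are taken in the complex numbers, so that
  an \<open>n \<times> n\<close> matrix has exactly \<open>n\<close> of them by definition.
\<close>

definition eigenvalues :: "real mat \<Rightarrow> complex multiset" where
  "eigenvalues M = proots (char_poly (map_mat complex_of_real M))"

definition entropy1 :: "complex multiset \<Rightarrow> real" where
  "entropy1 q =
     (let p = (\<lambda>x. cmod x / (\<Sum>y\<in>#q. cmod y)) in \<Sum>x\<in>#q. p x * (1 - p x))"

definition I1_Q :: "'v pair_pre_digraph \<Rightarrow> 'v list \<Rightarrow> real" where
  "I1_Q G vs = entropy1 (eigenvalues (signless_Laplacian G vs))"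

end

theory Submission
  imports Defs "Jordan_Normal_Form.Schur_Decomposition" "HOL-Analysis.Convex"
begin

text \<open>
  The signless Laplacian \<open>Q\<close> is symmetric and positive semidefinite, because its quadratic form is
  the sum of \<open>\<bar>x\<^sub>u + x\<^sub>v\<bar>\<^sup>2\<close> over the edges \<open>uv\<close>. So \<open>\<bar>q\<^sub>i\<bar> = q\<^sub>i\<close>, and the entropy depends only on the
  power sums \<open>\<Sum> q\<^sub>i = tr Q\<close> and \<open>\<Sum> q\<^sub>i\<^sup>2 = tr Q\<^sup>2\<close>. These are \<open>\<Sum> d\<close> and \<open>\<Sum> d\<^sup>2 + \<Sum> d\<close>, where \<open>d\<close> ranges over
  the vertex degrees and \<open>\<Sum> d = 2m\<close>. Hence (lemma \<open>I1_Q_eq\<close>)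
  \<open>I = 1 - 1 / (2m) - \<Sum> d\<^sup>2 / (\<Sum> d)\<^sup>2\<close>,
  and both parts become estimates of the ratio \<open>\<Sum> d\<^sup>2 / (\<Sum> d)\<^sup>2\<close>.

  The Cauchy-Schwarz inequality bounds the ratio from below by \<open>1 / n\<close>, which is part (i). For
  part (ii), the ratio is bounded from above by the reverse inequality of Polya and Szego, since
  \<open>1 / (2n) + (\<Delta>\<^sup>2 + \<delta>\<^sup>2) / (4n\<Delta>\<delta>) = (\<Delta> + \<delta>)\<^sup>2 / (4n\<Delta>\<delta>)\<close>. An exact identity
  (\<open>polya_szego_identity\<close>) writes the defect in this inequality as a square plus a multiple
  of the sum of the nonnegative terms \<open>(d - \<delta>) (\<Delta> - d)\<close>. Equality therefore says that every degree is extremal and that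
  \<open>(\<Delta> + \<delta>) \<Sum> d = 2n\<Delta>\<delta>\<close>; when \<open>\<Delta> \<noteq> \<delta>\<close>, the second condition fixes how many vertices have either
  degree.
\<close>

section \<open>Power sums of eigenvalues as traces\<close>

definition mat_trace :: "'a::comm_monoid_add mat \<Rightarrow> 'a" where
  "mat_trace A = (\<Sum>i<dim_row A. A $$ (i, i))"

lemma mat_trace_mult:
  assumes "A \<in> carrier_mat n k" "B \<in> carrier_mat k n"
  shows "mat_trace (A * B) = (\<Sum>i<n. \<Sum>j<k. A $$ (i, j) * B $$ (j, i))"
  using assms unfolding mat_trace_def
  by (auto simp: scalar_prod_def atLeast0LessThan intro!: sum.cong)

lemma mat_trace_mult_commute:
  fixes A B :: "'a::comm_semiring_0 mat"
  assumes "A \<in> carrier_mat n k" "B \<in> carrier_mat k n"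
  shows "mat_trace (A * B) = mat_trace (B * A)"
  unfolding mat_trace_mult[OF assms] mat_trace_mult[OF assms(2,1)]
  by (subst sum.swap) (simp add: mult.commute)

lemma mat_trace_similar:
  fixes A B :: "'a::comm_ring_1 mat"
  assumes "similar_mat A B"
  shows "mat_trace A = mat_trace B"
proof -
  obtain n P Q where carr: "A \<in> carrier_mat n n" "B \<in> carrier_mat n n"
      "P \<in> carrier_mat n n" "Q \<in> carrier_mat n n"
    and QP: "Q * P = 1\<^sub>m n" and A: "A = P * B * Q"
    using similar_matD[OF assms] by auto
  have "mat_trace A = mat_trace (Q * (P * B))"
    unfolding A using carr by (intro mat_trace_mult_commute) auto
  also have "Q * (P * B) = B"
    using carr QP by (simp flip: assoc_mult_mat)
  finally show ?thesis .
qed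

text \<open>
  In row \<open>i\<close> of \<open>A\<close> only the entries with column index at least \<open>i\<close> survive, in column \<open>j\<close> of \<open>B\<close> only
  those with row index at most \<open>j\<close>; for \<open>j \<le> i\<close> these overlap in at most one index.
\<close>
lemma upper_triangular_mult_entry:
  fixes A B :: "'a::semiring_0 mat"
  assumes A: "A \<in> carrier_mat n n" "upper_triangular A"
    and B: "B \<in> carrier_mat n n" "upper_triangular B"
    and ij: "j \<le> i" "i < n"
  shows "(A * B) $$ (i, j) = (if i = j then A $$ (i, i) * B $$ (i, i) else 0)"
proof -
  have "(A * B) $$ (i, j) = (\<Sum>k<n. A $$ (i, k) * B $$ (k, j))"
    using A B ij by (auto simp: scalar_prod_def atLeast0LessThan intro!: sum.cong)
  also have "\<dots> = (\<Sum>k<n. if k = i then (if i = j then A $$ (i, i) * B $$ (i, i) else 0) else 0)"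
  proof (intro sum.cong refl)
    fix k assume "k \<in> {..<n}"
    then have "A $$ (i, k) = 0" if "k < i" using that A ij by (auto simp: upper_triangular_def)
    moreover have "B $$ (k, j) = 0" if "k > j" using that B \<open>k \<in> _\<close> by (auto simp: upper_triangular_def)
    ultimately show "A $$ (i, k) * B $$ (k, j)
        = (if k = i then (if i = j then A $$ (i, i) * B $$ (i, i) else 0) else 0)"
      using ij by (cases k i rule: linorder_cases) auto
  qed
  also have "\<dots> = (if i = j then A $$ (i, i) * B $$ (i, i) else 0)"
    using ij by (simp add: sum.delta)
  finally show ?thesis .
qed

lemma upper_triangular_pow:
  fixes A :: "'a::semiring_1 mat"
  assumes A: "A \<in> carrier_mat n n" "upper_triangular A"
  shows "upper_triangular (A ^\<^sub>m k) \<and> (\<forall>i<n. (A ^\<^sub>m k) $$ (i, i) = A $$ (i, i) ^ k)"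
proof (induction k)
  case 0
  then show ?case using A by (auto simp: upper_triangular_def)
next
  case (Suc k)
  have Ak: "A ^\<^sub>m k \<in> carrier_mat n n" using A by simp
  note entry = upper_triangular_mult_entry[OF Ak _ A]
  show ?case
    using Suc entry Ak A by (auto simp: upper_triangular_def[of "A ^\<^sub>m k * A"] power_commutes)
qed

text \<open>
  Every complex matrix is similar to an upper triangular one with the eigenvalues, counted with
  multiplicity, on the diagonal (Schur). Powers of a triangular matrix have the powers of the
  diagonal entries on their diagonal, and the trace is invariant under similarity.
\<close>
lemma sum_eigenvalue_powers_eq_trace:
  fixes A :: "complex mat"
  assumes A: "A \<in> carrier_mat n n"
  shows "(\<Sum>x\<in>#proots (char_poly A). x ^ k) = mat_trace (A ^\<^sub>m k)"
proof -
  obtain es where es: "char_poly A = (\<Prod>e\<leftarrow>es. [:- e, 1:])"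
    using char_poly_factorized[OF A] by auto
  obtain B P Q where "schur_decomposition A es = (B, P, Q)"
    by (cases "schur_decomposition A es")
  from schur_decomposition[OF A es this]
  have wit: "similar_mat_wit A B P Q" and tri: "upper_triangular B" and diag: "diag_mat B = es"
    by auto
  have B: "B \<in> carrier_mat n n" using similar_mat_witD2[OF A wit] by auto
  have "proots (\<Prod>e\<leftarrow>es. [:- e, 1:]) = mset es"
  proof (induction es)
    case (Cons e es)
    have "(\<Prod>e\<leftarrow>es. [:- e, 1:]) \<noteq> 0" by (auto simp: prod_list_zero_iff)
    then have "proots ([:- e, 1:] * (\<Prod>e\<leftarrow>es. [:- e, 1:])) = {#e#} + mset es"
      by (subst proots_mult) (auto simp: Cons)
    then show ?case by (simp del: mult_pCons_left)
  qed simp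
  then have "proots (char_poly A) = mset es" by (simp only: es)
  then have "(\<Sum>x\<in>#proots (char_poly A). x ^ k) = (\<Sum>e\<leftarrow>es. e ^ k)"
    by (metis mset_map sum_mset_sum_list)
  also have "\<dots> = (\<Sum>i<n. B $$ (i, i) ^ k)"
    unfolding diag[symmetric] diag_mat_def using B
    by (simp add: o_def interv_sum_list_conv_sum_set_nat atLeast0LessThan)
  also have "\<dots> = mat_trace (B ^\<^sub>m k)"
    unfolding mat_trace_def using upper_triangular_pow[OF B tri, of k] B by simp
  also have "\<dots> = mat_trace (A ^\<^sub>m k)"
    using similar_mat_wit_pow[OF wit, of k]
    by (intro mat_trace_similar[symmetric]) (auto simp: similar_mat_def)
  finally show ?thesis .
qed

section \<open>Entropy in terms of power sums\<close>

lemma entropy1_eq: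
  assumes "(\<Sum>x\<in>#q. cmod x) \<noteq> 0"
  shows "entropy1 q = 1 - (\<Sum>x\<in>#q. (cmod x)\<^sup>2) / (\<Sum>x\<in>#q. cmod x)\<^sup>2"
proof -
  have diff: "(\<Sum>x\<in>#M. f x - g x) = (\<Sum>x\<in>#M. f x) - (\<Sum>x\<in>#M. g x)"
    for M :: "complex multiset" and f g :: "complex \<Rightarrow> real"
    by (induction M) auto
  define s where "s = (\<Sum>x\<in>#q. cmod x)"
  have "entropy1 q = (\<Sum>x\<in>#q. cmod x / s - (cmod x)\<^sup>2 / s\<^sup>2)"
    unfolding entropy1_def Let_def s_def[symmetric] by (simp add: algebra_simps power2_eq_square)
  also have "\<dots> = (\<Sum>x\<in>#q. cmod x / s) - (\<Sum>x\<in>#q. (cmod x)\<^sup>2 / s\<^sup>2)"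
    by (rule diff)
  also have "(\<Sum>x\<in>#q. cmod x / s) = 1"
    using assms unfolding s_def[symmetric]
    by (simp add: divide_inverse s_def flip: sum_mset_distrib_right)
  also have "(\<Sum>x\<in>#q. (cmod x)\<^sup>2 / s\<^sup>2) = (\<Sum>x\<in>#q. (cmod x)\<^sup>2) / s\<^sup>2"
    by (simp add: divide_inverse flip: sum_mset_distrib_right)
  finally show ?thesis by (simp add: s_def)
qed

text \<open>
  Nonnegative real numbers are their own moduli, so both sums in the entropy are power sums of
  complex numbers; for a spectrum, these are traces.
\<close>
lemma entropy1_eq_of_nonneg:
  assumes nonneg: "\<And>x. x \<in># q \<Longrightarrow> complex_of_real (cmod x) = x"
    and s: "(\<Sum>x\<in>#q. x) = complex_of_real s" and t: "(\<Sum>x\<in>#q. x\<^sup>2) = complex_of_real t"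
    and "s \<noteq> 0"
  shows "entropy1 q = 1 - t / s\<^sup>2"
proof -
  have of_real_sum: "complex_of_real (\<Sum>x\<in>#M. f x) = (\<Sum>x\<in>#M. complex_of_real (f x))"
    for M :: "complex multiset" and f
    by (induction M) auto
  have "complex_of_real (\<Sum>x\<in>#q. cmod x) = (\<Sum>x\<in>#q. x)"
    unfolding of_real_sum
    by (intro arg_cong[where f = sum_mset] image_mset_cong) (simp add: nonneg)
  moreover have "complex_of_real (\<Sum>x\<in>#q. (cmod x)\<^sup>2) = (\<Sum>x\<in>#q. x\<^sup>2)"
    unfolding of_real_sum
    by (intro arg_cong[where f = sum_mset] image_mset_cong) (simp add: nonneg)
  ultimately have "(\<Sum>x\<in>#q. cmod x) = s" "(\<Sum>x\<in>#q. (cmod x)\<^sup>2) = t"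
    using s t of_real_eq_iff by metis+
  then show ?thesis using entropy1_eq[of q] \<open>s \<noteq> 0\<close> by simp
qed

section \<open>The spectrum of the signless Laplacian\<close>

locale enumerated_graph = pair_graph G for G :: "'v pair_pre_digraph" +
  fixes vs :: "'v list"
  assumes distinct_vs: "distinct vs" and set_vs: "set vs = pverts G"
begin

abbreviation "adj i j \<equiv> (vs ! i, vs ! j) \<in> parcs G"

abbreviation "deg i \<equiv> vdegree G (vs ! i)"

lemma sym_parcs: "sym (parcs G)"
  using pair_sym_arcs by (simp add: symmetric_def)

lemma adj_sym: "adj i j \<longleftrightarrow> adj j i"
  using sym_parcs by (meson symD)

lemma not_adj_self: "\<not> adj i i"
  using pair_no_loops by force

lemma sum_vertices: "(\<Sum>v\<in>pverts G. f v) = (\<Sum>i<length vs. f (vs ! i))"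
  using sum.reindex_bij_betw[OF bij_betw_nth[OF distinct_vs refl refl], of f]
  by (simp add: set_vs)

lemma degree_eq_sum_adj:
  assumes "i < length vs"
  shows "of_nat (deg i) = (\<Sum>j<length vs. of_bool (adj i j))"
proof -
  have "bij_betw (\<lambda>v. (vs ! i, v)) {v \<in> pverts G. (vs ! i, v) \<in> parcs G} (out_arcs G (vs ! i))"
    by (rule bij_betwI[where g = snd]) (auto simp: in_arcsD2)
  then have "deg i = card {v \<in> pverts G. (vs ! i, v) \<in> parcs G}"
    unfolding vdegree_def out_degree_def by (simp add: bij_betw_same_card)
  moreover have "\<dots> = (\<Sum>v\<in>pverts G. of_bool ((vs ! i, v) \<in> parcs G))"
    using pair_finite_verts by (simp add: sum_of_bool_eq Int_def)
  ultimately have "deg i = (\<Sum>j<length vs. of_bool (adj i j))"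
    by (simp add: sum_vertices)
  then show ?thesis by simp
qed

text \<open>Without loops, the two orientations of an edge are different arcs.\<close>
lemma card_parcs: "card (parcs G) = 2 * card (edges G)"
proof -
  let ?g = "\<lambda>(u, v). {u, v}"
  have edges: "edges G = ?g ` parcs G" by (auto simp: edges_def)
  have "card (parcs G) = (\<Sum>e\<in>edges G. card {a \<in> parcs G. ?g a = e})"
    using sum.group[of "parcs G" "edges G" ?g "\<lambda>_. 1::nat"] pair_finite_arcs edges by simp
  also have "\<dots> = (\<Sum>e\<in>edges G. 2)"
  proof (intro sum.cong refl)
    fix e assume "e \<in> edges G"
    then obtain u v where uv: "(u, v) \<in> parcs G" "e = {u, v}" by (auto simp: edges_def)
    have vu: "(v, u) \<in> parcs G" using sym_parcs uv(1) by (rule symD)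
    have fibre: "?g a = e \<longleftrightarrow> a = (u, v) \<or> a = (v, u)" for a
      unfolding uv(2) by (cases a) (simp add: doubleton_eq_iff)
    have "{a \<in> parcs G. ?g a = e} = {(u, v), (v, u)}"
      by (rule Set.set_eqI) (simp only: mem_Collect_eq fibre insert_iff empty_iff, metis uv(1) vu)
    moreover have "u \<noteq> v" using pair_no_loops[OF uv(1)] by simp
    ultimately show "card {a \<in> parcs G. ?g a = e} = 2" by simp
  qed
  finally show ?thesis by simp
qed

lemma handshake: "(\<Sum>v\<in>pverts G. vdegree G v) = 2 * card (edges G)"
proof -
  have "(\<Sum>v\<in>pverts G. vdegree G v) = (\<Sum>v\<in>pverts G. card {a \<in> parcs G. fst a = v})"
    by (simp add: vdegree_def out_degree_def out_arcs_def)
  also have "\<dots> = card (parcs G)"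
  proof -
    have "fst ` parcs G \<subseteq> pverts G" using arc_fst_in_verts by blast
    then show ?thesis
      using sum.group[of "parcs G" "pverts G" fst "\<lambda>_. 1::nat"] pair_finite_arcs pair_finite_verts
      by simp
  qed
  finally show ?thesis by (simp add: card_parcs)
qed

abbreviation "Q \<equiv> signless_Laplacian G vs"

lemma Q_carrier: "Q \<in> carrier_mat (length vs) (length vs)"
  by (simp add: signless_Laplacian_def degree_matrix_def adjacency_matrix_def)

lemma Q_entry:
  assumes "i < length vs" "j < length vs"
  shows "Q $$ (i, j) = of_bool (i = j) * real (deg i) + of_bool (adj i j)"
  using assms by (simp add: signless_Laplacian_def degree_matrix_def adjacency_matrix_def)

lemma trace_Q: "mat_trace Q = (\<Sum>v\<in>pverts G. real (vdegree G v))"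
  using Q_carrier by (simp add: mat_trace_def Q_entry not_adj_self sum_vertices)

text \<open>
  As \<open>Q\<close> is symmetric, \<open>tr Q\<^sup>2\<close> is the sum of the squares of its entries. Row \<open>i\<close> contributes the square of
  the degree from the diagonal, and the degree once more from the entries \<open>1\<close> of the adjacency matrix.
\<close>
lemma trace_Q_squared:
  "mat_trace (Q * Q) = (\<Sum>v\<in>pverts G. (real (vdegree G v))\<^sup>2 + real (vdegree G v))"
proof -
  have "mat_trace (Q * Q) = (\<Sum>i<length vs. \<Sum>j<length vs. Q $$ (i, j) * Q $$ (j, i))"
    by (rule mat_trace_mult[OF Q_carrier Q_carrier])
  also have "\<dots> = (\<Sum>i<length vs. \<Sum>j<length vs.
      (if i = j then (real (deg i))\<^sup>2 else 0) + of_bool (adj i j))"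
    by (intro sum.cong refl) (auto simp: Q_entry not_adj_self adj_sym power2_eq_square)
  also have "\<dots> = (\<Sum>i<length vs. (real (deg i))\<^sup>2 + real (deg i))"
    by (intro sum.cong refl) (simp add: sum.distrib degree_eq_sum_adj
        del: sum_of_bool_eq sum_of_bool_mult_eq sum_mult_of_bool_eq)
  finally show ?thesis by (simp add: sum_vertices)
qed

abbreviation "Qc \<equiv> map_mat complex_of_real Q"

lemma Qc_carrier: "Qc \<in> carrier_mat (length vs) (length vs)"
  using Q_carrier by simp

text \<open>
  Each edge is counted once per orientation, whence the factor \<open>2\<close>. The form is taken over the complex
  numbers so that it applies to eigenvectors whose eigenvalues are not yet known to be real.
\<close>
lemma signless_quadratic_form:
  fixes x :: "nat \<Rightarrow> complex"
  shows "2 * (\<Sum>i<length vs. cnj (x i) * (\<Sum>j<length vs. Qc $$ (i, j) * x j))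
    = complex_of_real (\<Sum>i<length vs. \<Sum>j<length vs. of_bool (adj i j) * (cmod (x i + x j))\<^sup>2)"
proof -
  let ?N = "{..<length vs}"
  let ?a = "\<lambda>i j. of_bool (adj i j) :: complex"
  \<comment> \<open>The degree counts the neighbours, so the diagonal term is spread evenly over them.\<close>
  have diag: "(\<Sum>j\<in>?N. ?a i j * (cnj (x i) * x i)) = of_nat (deg i) * (cnj (x i) * x i)"
    if "i \<in> ?N" for i
    using that by (simp add: degree_eq_sum_adj sum_distrib_right
        del: sum_of_bool_eq sum_of_bool_mult_eq sum_mult_of_bool_eq)
  have form: "(\<Sum>i\<in>?N. cnj (x i) * (\<Sum>j\<in>?N. Qc $$ (i, j) * x j))
      = (\<Sum>i\<in>?N. \<Sum>j\<in>?N. ?a i j * (cnj (x i) * x i + cnj (x i) * x j))"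
  proof (intro sum.cong refl)
    fix i assume i: "i \<in> ?N"
    have "(\<Sum>j\<in>?N. Qc $$ (i, j) * x j)
        = (\<Sum>j\<in>?N. (if i = j then of_nat (deg i) * x i else 0) + ?a i j * x j)"
      using i Q_carrier by (intro sum.cong refl) (auto simp: Q_entry algebra_simps)
    also have "\<dots> = of_nat (deg i) * x i + (\<Sum>j\<in>?N. ?a i j * x j)"
      using i by (simp add: sum.distrib)
    finally show "cnj (x i) * (\<Sum>j\<in>?N. Qc $$ (i, j) * x j)
        = (\<Sum>j\<in>?N. ?a i j * (cnj (x i) * x i + cnj (x i) * x j))"
      using diag[OF i] by (simp add: distrib_left sum.distrib sum_distrib_left mult_ac
        del: sum_of_bool_eq sum_of_bool_mult_eq sum_mult_of_bool_eq)
  qed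
  \<comment> \<open>Exchange the end points of each arc; adding both versions of the sum completes the square
     \<open>(x\<^sub>i + x\<^sub>j) cnj (x\<^sub>i + x\<^sub>j)\<close>.\<close>
  also have "\<dots> = (\<Sum>i\<in>?N. \<Sum>j\<in>?N. ?a i j * (cnj (x j) * x j + cnj (x j) * x i))"
    by (subst sum.swap) (simp add: adj_sym)
  finally have "2 * (\<Sum>i\<in>?N. cnj (x i) * (\<Sum>j\<in>?N. Qc $$ (i, j) * x j))
      = (\<Sum>i\<in>?N. \<Sum>j\<in>?N. ?a i j * (cnj (x i) * x i + cnj (x i) * x j))
        + (\<Sum>i\<in>?N. \<Sum>j\<in>?N. ?a i j * (cnj (x j) * x j + cnj (x j) * x i))"
    using form by simp
  also have "\<dots> = (\<Sum>i\<in>?N. \<Sum>j\<in>?N. ?a i j * complex_of_real ((cmod (x i + x j))\<^sup>2))"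
    unfolding sum.distrib[symmetric] complex_norm_square
    by (intro sum.cong refl) (simp add: algebra_simps)
  finally show ?thesis by simp
qed

text \<open>
  An eigenvalue is the quotient of the quadratic form at an eigenvector and the square of its norm
  (its Rayleigh quotient), hence real and nonnegative, being a quotient of such numbers.
\<close>
lemma eigenvalue_nonneg:
  assumes "l \<in># eigenvalues Q"
  shows "complex_of_real (cmod l) = l"
proof -
  let ?N = "{..<length vs}"
  have "char_poly Qc \<noteq> 0"
    using degree_monic_char_poly[OF Qc_carrier] by auto
  then have "eigenvalue Qc l"
    using assms by (simp add: eigenvalue_root_char_poly[OF Qc_carrier] eigenvalues_def)
  then obtain v where v: "v \<in> carrier_vec (length vs)" "v \<noteq> 0\<^sub>v (length vs)" "Qc *\<^sub>v v = l \<cdot>\<^sub>v v"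
    using Qc_carrier by (auto simp: eigenvalue_def eigenvector_def)
  have row: "(\<Sum>j\<in>?N. Qc $$ (i, j) * v $ j) = l * v $ i" if "i < length vs" for i
  proof -
    have "(\<Sum>j\<in>?N. Qc $$ (i, j) * v $ j) = (Qc *\<^sub>v v) $ i"
      using that v(1) Qc_carrier by (auto simp: scalar_prod_def atLeast0LessThan intro!: sum.cong)
    then show ?thesis using v that by simp
  qed
  define E where "E = (\<Sum>i\<in>?N. \<Sum>j\<in>?N. of_bool (adj i j) * (cmod (v $ i + v $ j))\<^sup>2)"
  define S where "S = (\<Sum>i\<in>?N. (cmod (v $ i))\<^sup>2)"
  have "complex_of_real E = 2 * (\<Sum>i\<in>?N. cnj (v $ i) * (l * v $ i))"
    unfolding E_def signless_quadratic_form[symmetric] by (simp add: row)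
  also have "\<dots> = l * complex_of_real (2 * S)"
    unfolding S_def of_real_mult of_real_sum complex_norm_square
    by (simp add: sum_distrib_left mult_ac)
  finally have E: "complex_of_real E = l * complex_of_real (2 * S)" .
  obtain k where "k < length vs" "v $ k \<noteq> 0"
    using v by (metis eq_vecI carrier_vecD index_zero_vec)
  then have "S > 0"
    unfolding S_def by (intro sum_pos2[of _ k]) auto
  then have "l = complex_of_real (E / (2 * S))"
    using E by (simp add: field_simps)
  moreover have "E / (2 * S) \<ge> 0"
    using \<open>S > 0\<close> by (auto simp: E_def intro!: divide_nonneg_pos sum_nonneg)
  ultimately show ?thesis by (metis abs_of_nonneg norm_of_real)
qed

text \<open>
  With \<open>s = \<Sum> d = 2m\<close> and \<open>t = \<Sum> d\<^sup>2\<close>, the entropy is \<open>1 - (t + s) / s\<^sup>2\<close>, and the summand \<open>s / s\<^sup>2\<close> is \<open>1 / (2m)\<close>.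
\<close>
lemma I1_Q_eq:
  assumes "card (edges G) > 0"
  shows "I1_Q G vs = 1 - 1 / (2 * real (card (edges G)))
    - (\<Sum>v\<in>pverts G. (real (vdegree G v))\<^sup>2) / (\<Sum>v\<in>pverts G. real (vdegree G v))\<^sup>2"
proof -
  let ?s = "\<Sum>v\<in>pverts G. real (vdegree G v)"
  let ?t = "\<Sum>v\<in>pverts G. (real (vdegree G v))\<^sup>2"
  have s: "?s = 2 * real (card (edges G))"
    using handshake by (simp flip: of_nat_sum)
  have trace: "mat_trace (Qc ^\<^sub>m k) = complex_of_real (mat_trace (Q ^\<^sub>m k))" for k
    using Q_carrier by (simp add: mat_trace_def flip: of_real_hom.mat_hom_pow[OF Q_carrier])
  have "(\<Sum>x\<in>#eigenvalues Q. x) = complex_of_real ?s"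
    using sum_eigenvalue_powers_eq_trace[OF Qc_carrier, of 1] trace[of 1] Q_carrier
    by (simp add: eigenvalues_def trace_Q)
  moreover have "(\<Sum>x\<in>#eigenvalues Q. x\<^sup>2) = complex_of_real (?t + ?s)"
    using sum_eigenvalue_powers_eq_trace[OF Qc_carrier, of 2] trace[of 2] Q_carrier
    by (simp add: eigenvalues_def trace_Q_squared sum.distrib numeral_2_eq_2)
  ultimately have "entropy1 (eigenvalues Q) = 1 - (?t + ?s) / ?s\<^sup>2"
    using eigenvalue_nonneg s assms by (intro entropy1_eq_of_nonneg) auto
  also have "\<dots> = 1 - 1 / ?s - ?t / ?s\<^sup>2"
    using s assms by (simp add: add_divide_distrib power2_eq_square)
  finally show ?thesis by (simp add: I1_Q_def s)
qed

end

section \<open>A reverse Cauchy-Schwarz inequality\<close>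

text \<open>
  Expanding \<open>\<Sum> (f x - a) (b - f x)\<close> expresses \<open>\<Sum> (f x)\<^sup>2\<close> through this sum and \<open>\<Sum> f x\<close>. After substitution,
  the left-hand side contains a quadratic polynomial in \<open>\<Sum> f x\<close>, which is a perfect square. When \<open>a \<le> f x \<le> b\<close> and
  \<open>a, b > 0\<close>, both terms on the right are nonnegative, so the identity yields the inequality together
  with its equality case.
\<close>
lemma polya_szego_identity:
  fixes f :: "'a \<Rightarrow> real"
  shows "(b + a)\<^sup>2 * (\<Sum>x\<in>A. f x)\<^sup>2 - 4 * real (card A) * b * a * (\<Sum>x\<in>A. (f x)\<^sup>2)
    = ((b + a) * (\<Sum>x\<in>A. f x) - 2 * real (card A) * b * a)\<^sup>2
      + 4 * real (card A) * b * a * (\<Sum>x\<in>A. (f x - a) * (b - f x))"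
proof -
  have "(\<Sum>x\<in>A. (f x - a) * (b - f x)) = (\<Sum>x\<in>A. (b + a) * f x - (f x)\<^sup>2 - a * b)"
    by (simp add: algebra_simps power2_eq_square)
  also have "\<dots> = (b + a) * (\<Sum>x\<in>A. f x) - (\<Sum>x\<in>A. (f x)\<^sup>2) - real (card A) * a * b"
    by (simp add: sum_subtractf sum_distrib_left)
  finally have D: "(\<Sum>x\<in>A. (f x - a) * (b - f x))
    = (b + a) * (\<Sum>x\<in>A. f x) - (\<Sum>x\<in>A. (f x)\<^sup>2) - real (card A) * a * b" .
  show ?thesis unfolding D by (simp add: algebra_simps power2_eq_square)
qed

lemma polya_szego:
  fixes f :: "'a \<Rightarrow> real"
  assumes "finite A" "A \<noteq> {}" "a > 0" and bounds: "\<And>x. x \<in> A \<Longrightarrow> a \<le> f x \<and> f x \<le> b"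
  shows polya_szego_ineq:
      "(\<Sum>x\<in>A. (f x)\<^sup>2) / (\<Sum>x\<in>A. f x)\<^sup>2 \<le> (b + a)\<^sup>2 / (4 * real (card A) * b * a)" (is ?le)
    and polya_szego_eq_iff:
      "(\<Sum>x\<in>A. (f x)\<^sup>2) / (\<Sum>x\<in>A. f x)\<^sup>2 = (b + a)\<^sup>2 / (4 * real (card A) * b * a)
        \<longleftrightarrow> (\<forall>x\<in>A. f x = a \<or> f x = b) \<and> (b + a) * (\<Sum>x\<in>A. f x) = 2 * real (card A) * b * a"
      (is "?eq \<longleftrightarrow> ?cond")
proof -
  define c where "c = 4 * real (card A) * b * a"
  define S where "S = (\<Sum>x\<in>A. f x)"
  define P where "P = (\<Sum>x\<in>A. (f x)\<^sup>2)"
  define D where "D = (\<Sum>x\<in>A. (f x - a) * (b - f x))"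
  obtain y where "y \<in> A" using \<open>A \<noteq> {}\<close> by auto
  then have "b > 0" using bounds[of y] \<open>a > 0\<close> by linarith
  then have c: "c > 0" using assms by (simp add: c_def card_gt_0_iff)
  have S: "S > 0"
    unfolding S_def using assms(1-3) bounds by (intro sum_pos) (auto intro: less_le_trans)
  have terms: "(f x - a) * (b - f x) \<ge> 0" if "x \<in> A" for x
    using bounds[OF that] by simp
  then have D: "D \<ge> 0" unfolding D_def by (intro sum_nonneg)
  have D0: "D = 0 \<longleftrightarrow> (\<forall>x\<in>A. f x = a \<or> f x = b)"
    unfolding D_def using terms \<open>finite A\<close> by (subst sum_nonneg_eq_0_iff) auto
  have "(b + a)\<^sup>2 / c - P / S\<^sup>2 = ((b + a)\<^sup>2 * S\<^sup>2 - c * P) / (c * S\<^sup>2)"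
    using c S by (simp add: field_simps)
  also have "\<dots> = (((b + a) * S - 2 * real (card A) * b * a)\<^sup>2 + c * D) / (c * S\<^sup>2)"
    using polya_szego_identity[of b a f A] by (simp add: c_def S_def P_def D_def)
  finally have gap: "(b + a)\<^sup>2 / c - P / S\<^sup>2
    = (((b + a) * S - 2 * real (card A) * b * a)\<^sup>2 + c * D) / (c * S\<^sup>2)" .
  have "(b + a)\<^sup>2 / c - P / S\<^sup>2 \<ge> 0" unfolding gap using c D by simp
  then show ?le by (simp add: c_def P_def S_def)
  have "(b + a)\<^sup>2 / c - P / S\<^sup>2 = 0
      \<longleftrightarrow> ((b + a) * S - 2 * real (card A) * b * a)\<^sup>2 + c * D = 0"
    unfolding gap using c S by simp
  also have "\<dots> \<longleftrightarrow> (b + a) * S = 2 * real (card A) * b * a \<and> D = 0"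
    using c D by (subst add_nonneg_eq_0_iff) auto
  finally show "?eq \<longleftrightarrow> ?cond" unfolding D0 c_def P_def S_def by auto
qed

text \<open>
  If \<open>p\<close> points have the value \<open>b\<close> and \<open>q\<close> points the value \<open>a\<close>, then the two sides of the sum condition
  differ by \<open>(b - a) (p b - q a)\<close>. So the condition means \<open>p b = q a\<close>, which, as \<open>p + q = n\<close>,
  determines both multiplicities up to the factor \<open>a + b\<close>.
\<close>
lemma two_valued_sum_iff:
  fixes f :: "'a \<Rightarrow> real"
  assumes A: "finite A" and "a \<noteq> b" and vals: "\<And>x. x \<in> A \<Longrightarrow> f x = a \<or> f x = b"
  shows "(b + a) * (\<Sum>x\<in>A. f x) = 2 * real (card A) * b * a
    \<longleftrightarrow> real (card {x \<in> A. f x = b}) * (a + b) = a * real (card A)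
      \<and> real (card {x \<in> A. f x = a}) * (a + b) = b * real (card A)"
proof -
  define p q where "p = real (card {x \<in> A. f x = b})" and "q = real (card {x \<in> A. f x = a})"
  have split: "A = {x \<in> A. f x = b} \<union> {x \<in> A. f x = a}"
    and disj: "{x \<in> A. f x = b} \<inter> {x \<in> A. f x = a} = {}"
    using vals \<open>a \<noteq> b\<close> by auto
  have n: "real (card A) = p + q"
    unfolding p_def q_def using A disj by (subst split, subst card_Un_disjoint) auto
  have S: "(\<Sum>x\<in>A. f x) = p * b + q * a"
    unfolding p_def q_def using A disj by (subst split, subst sum.union_disjoint) auto
  have "(b + a) * (p * b + q * a) - 2 * (p + q) * b * a = (b - a) * (p * b - q * a)"
    by (simp add: algebra_simps)
  then have "(b + a) * (p * b + q * a) = 2 * (p + q) * b * a \<longleftrightarrow> p * b = q * a"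
    using \<open>a \<noteq> b\<close> by (metis eq_iff_diff_eq_0 mult_eq_0_iff)
  then show ?thesis
    unfolding S n p_def[symmetric] q_def[symmetric] by (auto simp: algebra_simps)
qed

text \<open>
  The equality case for degree sequences. For \<open>\<Delta> = \<delta>\<close> both sides hold; for \<open>\<Delta> \<noteq> \<delta>\<close> the graph is not regular,
  as both extremal degrees occur, and the vertex counts come from \<open>two_valued_sum_iff\<close>. The
  divisibility is a consequence of these counts being integers.
\<close>
lemma (in pair_graph) extremal_degrees_iff:
  fixes \<delta> \<Delta> :: nat
  defines "\<delta> \<equiv> min_degree G" and "\<Delta> \<equiv> max_degree G" and "n \<equiv> card (pverts G)"
  assumes ne: "pverts G \<noteq> {}" and pos: "\<delta> > 0"
  shows "(\<forall>v\<in>pverts G. real (vdegree G v) = \<delta> \<or> real (vdegree G v) = \<Delta>)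
      \<and> (real \<Delta> + real \<delta>) * (\<Sum>v\<in>pverts G. real (vdegree G v)) = 2 * real n * \<Delta> * \<delta>
    \<longleftrightarrow> regular G \<or>
      (\<Delta> \<noteq> \<delta> \<and> vdegree G ` pverts G = {\<Delta>, \<delta>} \<and> (\<Delta> + \<delta>) dvd (\<delta> * n)
        \<and> real (card {v \<in> pverts G. vdegree G v = \<Delta>}) = real (\<delta> * n) / real (\<delta> + \<Delta>)
        \<and> real (card {v \<in> pverts G. vdegree G v = \<delta>}) = real (\<Delta> * n) / real (\<delta> + \<Delta>))"
    (is "?vals \<and> ?sum \<longleftrightarrow> regular G \<or> ?two")
proof -
  let ?V = "pverts G"
  have fin: "finite (vdegree G ` ?V)" using pair_finite_verts by simp
  have \<delta>: "\<delta> \<in> vdegree G ` ?V" and \<Delta>: "\<Delta> \<in> vdegree G ` ?V"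
    unfolding \<delta>_def \<Delta>_def min_degree_def max_degree_def using fin ne by (auto intro!: Min_in Max_in)
  show ?thesis
  proof (cases "\<Delta> = \<delta>")
    case True
    have "vdegree G v = \<delta>" if "v \<in> ?V" for v
    proof (rule antisym)
      show "\<delta> \<le> vdegree G v"
        unfolding \<delta>_def min_degree_def using that fin by (intro Min_le) auto
      show "vdegree G v \<le> \<delta>"
        unfolding True[symmetric] unfolding \<Delta>_def max_degree_def using that fin by (intro Max_ge) auto
    qed
    then show ?thesis using True by (auto simp: regular_def n_def)
  next
    case False
    have not_regular: "\<not> regular G"
      using \<delta> \<Delta> False unfolding regular_def by (metis imageE)
    have vals_iff: "?vals \<longleftrightarrow> vdegree G ` ?V = {\<Delta>, \<delta>}"
      using \<delta> \<Delta> by auto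
    have sum_iff: "?sum \<longleftrightarrow>
        real (card {v \<in> ?V. vdegree G v = \<Delta>}) = real (\<delta> * n) / real (\<delta> + \<Delta>)
        \<and> real (card {v \<in> ?V. vdegree G v = \<delta>}) = real (\<Delta> * n) / real (\<delta> + \<Delta>)" if ?vals
      using two_valued_sum_iff[of ?V \<delta> \<Delta> "\<lambda>v. real (vdegree G v)"] that False pos pair_finite_verts
      by (simp add: n_def eq_divide_eq)
    have "(\<Delta> + \<delta>) dvd (\<delta> * n)"
      if "real (card {v \<in> ?V. vdegree G v = \<Delta>}) = real (\<delta> * n) / real (\<delta> + \<Delta>)"
    proof -
      have "real (card {v \<in> ?V. vdegree G v = \<Delta>} * (\<delta> + \<Delta>)) = real (\<delta> * n)"
        using that pos by (simp add: eq_divide_eq)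
      then have "card {v \<in> ?V. vdegree G v = \<Delta>} * (\<delta> + \<Delta>) = \<delta> * n" by (rule of_nat_eq_iff[THEN iffD1])
      then show ?thesis by (metis add.commute dvd_triv_right)
    qed
    then show ?thesis using not_regular vals_iff sum_iff False by blast
  qed
qed

theorem corollary3p2:
  fixes G :: "'v pair_pre_digraph" and vs :: "'v list" and n m \<delta> \<Delta> :: nat
  assumes "pair_graph G"
    and "distinct vs" and "set vs = pverts G"
    and "n = card (pverts G)" and "m = card (edges G)"
    and "\<delta> = min_degree G" and "\<Delta> = max_degree G"
    and "m > 0"
  shows "I1_Q G vs \<le> 1 - 1 / (2 * real m) - 1 / real n
    \<and> (\<delta> > 0 \<longrightarrow>
        I1_Q G vs \<ge> 1 - 1 / (2 * real m) - 1 / (2 * real n)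
          - ((real \<Delta>)\<^sup>2 + (real \<delta>)\<^sup>2) / (4 * real n * real \<Delta> * real \<delta>)
      \<and> (I1_Q G vs = 1 - 1 / (2 * real m) - 1 / (2 * real n)
          - ((real \<Delta>)\<^sup>2 + (real \<delta>)\<^sup>2) / (4 * real n * real \<Delta> * real \<delta>)
        \<longleftrightarrow> regular G \<or>
          (\<Delta> \<noteq> \<delta> \<and> vdegree G ` pverts G = {\<Delta>, \<delta>} \<and> (\<Delta> + \<delta>) dvd (\<delta> * n)
           \<and> real (card {v \<in> pverts G. vdegree G v = \<Delta>}) = real (\<delta> * n) / real (\<delta> + \<Delta>)
           \<and> real (card {v \<in> pverts G. vdegree G v = \<delta>}) = real (\<Delta> * n) / real (\<delta> + \<Delta>))))"
proof -
  interpret enumerated_graph G vs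
    using assms(1-3) by (simp add: enumerated_graph_def enumerated_graph_axioms_def)
  let ?V = "pverts G" and ?d = "\<lambda>v. real (vdegree G v)"
  let ?r = "(\<Sum>v\<in>?V. (?d v)\<^sup>2) / (\<Sum>v\<in>?V. ?d v)\<^sup>2"
  have I: "I1_Q G vs = 1 - 1 / (2 * real m) - ?r"
    using I1_Q_eq \<open>m > 0\<close> unfolding \<open>m = card (edges G)\<close> by simp
  have sum: "(\<Sum>v\<in>?V. ?d v) > 0"
    using handshake \<open>m > 0\<close> unfolding \<open>m = card (edges G)\<close> by (simp flip: of_nat_sum)
  then have ne: "?V \<noteq> {}" by auto
  then have n: "n > 0" using assms(4) pair_finite_verts by (simp add: card_gt_0_iff)
  have "(\<Sum>v\<in>?V. ?d v)\<^sup>2 \<le> (\<Sum>v\<in>?V. (?d v)\<^sup>2) * real n"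
    unfolding assms(4) by (rule sum_squared_le_sum_of_squares)
  then have "1 / real n \<le> ?r"
    using n sum by (simp add: field_simps)
  then have upper: "I1_Q G vs \<le> 1 - 1 / (2 * real m) - 1 / real n"
    unfolding I by simp
  have bounds: "real \<delta> \<le> ?d v \<and> ?d v \<le> real \<Delta>" if "v \<in> ?V" for v
    using that pair_finite_verts unfolding assms(6,7) min_degree_def max_degree_def by simp
  have bound_eq: "1 - 1 / (2 * real m) - 1 / (2 * real n)
      - ((real \<Delta>)\<^sup>2 + (real \<delta>)\<^sup>2) / (4 * real n * real \<Delta> * real \<delta>)
    = 1 - 1 / (2 * real m) - (real \<Delta> + real \<delta>)\<^sup>2 / (4 * real n * real \<Delta> * real \<delta>)" if "\<delta> > 0"
  proof -
    obtain v where "v \<in> ?V" using ne by auto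
    then have "\<Delta> > 0" using bounds[of v] that by linarith
    then show ?thesis using that n by (simp add: field_simps power2_eq_square)
  qed
  show ?thesis
  proof (intro conjI upper impI)
    assume \<delta>: "\<delta> > 0"
    show "I1_Q G vs \<ge> 1 - 1 / (2 * real m) - 1 / (2 * real n)
        - ((real \<Delta>)\<^sup>2 + (real \<delta>)\<^sup>2) / (4 * real n * real \<Delta> * real \<delta>)"
      unfolding bound_eq[OF \<delta>] I
      using polya_szego_ineq[OF pair_finite_verts ne, of "real \<delta>" ?d "real \<Delta>"] bounds \<delta> assms(4)
      by simp
    show "I1_Q G vs = 1 - 1 / (2 * real m) - 1 / (2 * real n)
          - ((real \<Delta>)\<^sup>2 + (real \<delta>)\<^sup>2) / (4 * real n * real \<Delta> * real \<delta>)
        \<longleftrightarrow> regular G \<or>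
          (\<Delta> \<noteq> \<delta> \<and> vdegree G ` pverts G = {\<Delta>, \<delta>} \<and> (\<Delta> + \<delta>) dvd (\<delta> * n)
           \<and> real (card {v \<in> pverts G. vdegree G v = \<Delta>}) = real (\<delta> * n) / real (\<delta> + \<Delta>)
           \<and> real (card {v \<in> pverts G. vdegree G v = \<delta>}) = real (\<Delta> * n) / real (\<delta> + \<Delta>))"
      (is "_ \<longleftrightarrow> ?extremal")
    proof -
      have "I1_Q G vs = 1 - 1 / (2 * real m)
            - (real \<Delta> + real \<delta>)\<^sup>2 / (4 * real n * real \<Delta> * real \<delta>)
          \<longleftrightarrow> ?r = (real \<Delta> + real \<delta>)\<^sup>2 / (4 * real n * real \<Delta> * real \<delta>)"
        unfolding I by linarith
      also have "\<dots> \<longleftrightarrow> (\<forall>v\<in>?V. ?d v = real \<delta> \<or> ?d v = real \<Delta>)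
          \<and> (real \<Delta> + real \<delta>) * (\<Sum>v\<in>?V. ?d v) = 2 * real n * real \<Delta> * real \<delta>"
        unfolding assms(4) using \<delta> bounds
        by (intro polya_szego_eq_iff[OF pair_finite_verts ne]) auto
      also have "\<dots> \<longleftrightarrow> ?extremal"
        using extremal_degrees_iff[OF ne] \<delta> unfolding assms(4,6,7) by blast
      finally show ?thesis unfolding bound_eq[OF \<delta>] .
    qed
  qed
qed

end
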